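(* Let $\{(X_i,Y_i)\}_{i\ge 1}$ be a stationary ergodic sequence of random vectors with values in $\mathbb{R}^d\times\mathbb{R}$ such that $E|Y_1|<\infty$; let $(X,Y)$ have the common distribution of the $(X_i,Y_i)$ and let $\mu$ be the distribution of $X$. Let $L>0$ and let $N_n$ be a non-decreasing sequence of positive integers with $N_n\to\infty$. With the kernel $K$, the set $S$, $m^*_L$ and $\hat m^*_{n,L}$ as in the context, the following hold. (a) Almost surely, for all $x\in S$ simultaneously, $\hat m^*_{n,L}(x)\to m^*_L(x)$. (b) If $S$ is a bounded subset of $\mathbb{R}^d$, then almost surely $\sup_{x\in S}|\hat m^*_{n,L}(x)-m^*_L(x)|\to0$. (c) If either (i) $|Y|\le D<\infty$ almost surely for some constant $D$ (which need not be known), or (ii) $\mu$ has bounded support, then almost surely $\int(\hat m^*_{n,L}(x)-m^*_L(x))^2\mu(dx)\to0$.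
   Context: $K:\mathbb{R}^d\to[0,\infty)$ is a continuous kernel satisfying $b\,1_{\{x\in S_{0,r}\}}\le K(x)\le 1_{\{x\in S_{0,1}\}}$ for some constants $0<b\le1$ and $0<r<1$, where $S_{z,\rho}$ denotes the closed Euclidean ball of center $z$ and radius $\rho$. Let $h_k=2^{-k-2}$. The support is $S=\{x\in\mathbb{R}^d:\mu(S_{x,1/k})>0\text{ for all }k\ge1\}$. For $x\in S$, $M^*_k(x)=\frac{E(YK((X-x)/h_k))}{E(K((X-x)/h_k))}$; for $k\ge2$, $\Delta^*_{k,L}(x)=\mathrm{sign}(M^*_k(x)-M^*_{k-1}(x))\min(|M^*_k(x)-M^*_{k-1}(x)|,L2^{-k})$; and $m^*_L(x)=M^*_1(x)+\sum_{k=2}^\infty\Delta^*_{k,L}(x)$. Estimator: $\hat M^*_{k,n}(x)=\frac{\sum_{j=1}^nY_jK((X_j-x)/h_k)}{\sum_{j=1}^nK((X_j-x)/h_k)}$ with the convention $0/0=0$; for $k\ge2$, $\hat\Delta^*_{k,n,L}(x)=\mathrm{sign}(\hat M^*_{k,n}(x)-\hat M^*_{k-1,n}(x))\min(|\hat M^*_{k,n}(x)-\hat M^*_{k-1,n}(x)|,L2^{-k})$; and $\hat m^*_{n,L}(x)=\hat M^*_{1,n}(x)+\sum_{k=2}^{N_n}\hat\Delta^*_{k,n,L}(x)$. *)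

theory Defs
  imports "HOL-Probability.Probability"
begin

definition path_space :: "'b::topological_space measure \<Rightarrow> (nat \<Rightarrow> 'b) measure" where
  "path_space B = Pi\<^sub>M UNIV (\<lambda>_. B)"

definition path_law :: "'m measure \<Rightarrow> (nat \<Rightarrow> 'm \<Rightarrow> 'b::topological_space) \<Rightarrow> (nat \<Rightarrow> 'b) measure" where
  "path_law M Z = distr M (path_space borel) (\<lambda>\<omega> i. Z i \<omega>)"

definition stationary_process :: "'m measure \<Rightarrow> (nat \<Rightarrow> 'm \<Rightarrow> 'b::topological_space) \<Rightarrow> bool" where
  "stationary_process M Z \<longleftrightarrow>
     (\<forall>i. Z i \<in> borel_measurable M) \<and>
     (\<forall>k. path_law M (\<lambda>i. Z (i + k)) = path_law M Z)"

definition ergodic_process :: "'m measure \<Rightarrow> (nat \<Rightarrow> 'm \<Rightarrow> 'b::topological_space) \<Rightarrow> bool" where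
  "ergodic_process M Z \<longleftrightarrow>
     (\<forall>A \<in> sets (path_space borel).
        (\<lambda>\<omega> i. \<omega> (Suc i)) -` A \<inter> space (path_space borel) = A \<longrightarrow>
        measure (path_law M Z) A = 0 \<or> measure (path_law M Z) A = 1)"

definition hbw :: "nat \<Rightarrow> real" where
  "hbw k = 2 powr (- real k - 2)"

definition supp :: "'a::metric_space measure \<Rightarrow> 'a set" where
  "supp \<mu> = {x. \<forall>k::nat. k \<ge> 1 \<longrightarrow> measure \<mu> (cball x (1 / real k)) > 0}"

definition clip :: "real \<Rightarrow> nat \<Rightarrow> real \<Rightarrow> real" where
  "clip L k a = sgn a * min \<bar>a\<bar> (L * 2 powr (- real k))"

text \<open>M*_k(x), using (X,Y) = (X 0, Y 0).\<close>
definition Mstar :: "'m measure \<Rightarrow> ('a::euclidean_space \<Rightarrow> real) \<Rightarrow> (nat \<Rightarrow> 'm \<Rightarrow> 'a) \<Rightarrow>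
    (nat \<Rightarrow> 'm \<Rightarrow> real) \<Rightarrow> nat \<Rightarrow> 'a \<Rightarrow> real" where
  "Mstar M K X Y k x =
     (\<integral>\<omega>. Y 0 \<omega> * K ((1 / hbw k) *\<^sub>R (X 0 \<omega> - x)) \<partial>M) /
     (\<integral>\<omega>. K ((1 / hbw k) *\<^sub>R (X 0 \<omega> - x)) \<partial>M)"

definition mstar :: "'m measure \<Rightarrow> ('a::euclidean_space \<Rightarrow> real) \<Rightarrow> (nat \<Rightarrow> 'm \<Rightarrow> 'a) \<Rightarrow>
    (nat \<Rightarrow> 'm \<Rightarrow> real) \<Rightarrow> real \<Rightarrow> 'a \<Rightarrow> real" where
  "mstar M K X Y L x =
     Mstar M K X Y 1 x +
     (\<Sum>j. clip L (j + 2) (Mstar M K X Y (j + 2) x - Mstar M K X Y (j + 1) x))"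

text \<open>Estimator hat M*_{k,n}(x) based on the first n observations (indices 0..n-1);
  division by zero yields 0 in Isabelle, matching the convention 0/0 = 0.\<close>
definition Mhat :: "('a::euclidean_space \<Rightarrow> real) \<Rightarrow> (nat \<Rightarrow> 'm \<Rightarrow> 'a) \<Rightarrow>
    (nat \<Rightarrow> 'm \<Rightarrow> real) \<Rightarrow> nat \<Rightarrow> nat \<Rightarrow> 'a \<Rightarrow> 'm \<Rightarrow> real" where
  "Mhat K X Y k n x \<omega> =
     (\<Sum>j<n. Y j \<omega> * K ((1 / hbw k) *\<^sub>R (X j \<omega> - x))) /
     (\<Sum>j<n. K ((1 / hbw k) *\<^sub>R (X j \<omega> - x)))"

definition mhat :: "('a::euclidean_space \<Rightarrow> real) \<Rightarrow> (nat \<Rightarrow> 'm \<Rightarrow> 'a) \<Rightarrow>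
    (nat \<Rightarrow> 'm \<Rightarrow> real) \<Rightarrow> (nat \<Rightarrow> nat) \<Rightarrow> real \<Rightarrow> nat \<Rightarrow> 'a \<Rightarrow> 'm \<Rightarrow> real" where
  "mhat K X Y N L n x \<omega> =
     Mhat K X Y 1 n x \<omega> +
     (\<Sum>k=2..N n. clip L k (Mhat K X Y k n x \<omega> - Mhat K X Y (k - 1) n x \<omega>))"

end

theory Submission
  imports Defs
begin

text \<open>
  Birkhoff's ergodic theorem gives, almost surely and for all centres \<open>x\<close> in a countable dense set,
  convergence of the kernel-weighted averages of \<open>1\<close> and of \<open>Y\<close>. As \<open>K\<close> is uniformly continuous,
  these averages are equicontinuous in \<open>x\<close>, so they converge uniformly on compact sets. The limit
  of the denominators is continuous and positive on the support, hence each
  \<open>Mhat\<close> converges uniformly on compact subsets of the (closed) support. The truncation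
  \<open>clip\<close> is 1-Lipschitz and bounded by a summable sequence, so this passes to the whole series.
  Singletons give (a); the support itself, when it is compact, gives (b) and (c)(ii);
  (c)(i) is (a) together with dominated convergence.
\<close>

section \<open>Birkhoff's ergodic theorem for ergodic transformations\<close>

text \<open>\<open>T\<close> may be non-invertible, as the one-sided shift is. Ergodicity concerns
  strictly invariant sets, matching \<open>ergodic_process\<close>, so an event fed to it must be
  invariant exactly and not just up to a null set.\<close>

locale ergodic_pmp = prob_space P for P :: "'w measure" +
  fixes T :: "'w \<Rightarrow> 'w"
  assumes T_measurable [measurable]: "T \<in> measurable P P"
    and T_preserves: "distr P P T = P"
    and T_ergodic: "\<And>A. A \<in> sets P \<Longrightarrow> T -` A \<inter> space P = A \<Longrightarrow> prob A = 0 \<or> prob A = 1"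

abbreviation birkhoff_sum :: "('w \<Rightarrow> 'w) \<Rightarrow> ('w \<Rightarrow> real) \<Rightarrow> nat \<Rightarrow> 'w \<Rightarrow> real" where
  "birkhoff_sum T F n \<omega> \<equiv> (\<Sum>i<n. F ((T ^^ i) \<omega>))"

lemma birkhoff_sum_Suc_shift:
  "birkhoff_sum T F (Suc n) \<omega> = F \<omega> + birkhoff_sum T F n (T \<omega>)"
  by (simp add: sum.lessThan_Suc_shift funpow_swap1 del: sum.lessThan_Suc)

text \<open>This is the maximum of the Birkhoff sums of lengths 0 to \<open>n\<close>. Peeling off
  the first step relates the value at \<open>\<omega>\<close> to the one at
  \<open>T \<omega>\<close>, which is what Garsia's argument needs.\<close>

primrec max_sum :: "('w \<Rightarrow> 'w) \<Rightarrow> ('w \<Rightarrow> real) \<Rightarrow> nat \<Rightarrow> 'w \<Rightarrow> real" where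
  "max_sum T G 0 \<omega> = 0"
| "max_sum T G (Suc n) \<omega> = max 0 (G \<omega> + max_sum T G n (T \<omega>))"

lemma birkhoff_sum_le_max_sum: "birkhoff_sum T G n \<omega> \<le> max_sum T G n \<omega>"
proof (induction n arbitrary: \<omega>)
  case (Suc n)
  from Suc[of "T \<omega>"] show ?case
    unfolding birkhoff_sum_Suc_shift by simp
qed simp

lemma max_sum_mono_Suc: "max_sum T G n \<omega> \<le> max_sum T G (Suc n) \<omega>"
proof (induction n arbitrary: \<omega>)
  case (Suc n)
  from Suc[of "T \<omega>"] show ?case by (simp del: max_sum.simps(2) add: max_sum.simps(2)[of T G n \<omega>] max_sum.simps(2)[of T G "Suc n" \<omega>])
qed simp

lemma max_sum_mono: "m \<le> n \<Longrightarrow> max_sum T G m \<omega> \<le> max_sum T G n \<omega>"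
  by (rule lift_Suc_mono_le[of "\<lambda>n. max_sum T G n \<omega>"]) (rule max_sum_mono_Suc)

context ergodic_pmp
begin

lemma integrable_comp_T:
  fixes f :: "'w \<Rightarrow> real"
  assumes "integrable P f" shows "integrable P (\<lambda>\<omega>. f (T \<omega>))"
  using assms integrable_distr_eq[OF T_measurable, of f] T_preserves by auto

lemma integral_comp_T:
  fixes f :: "'w \<Rightarrow> real"
  assumes "integrable P f" shows "(\<integral>\<omega>. f (T \<omega>) \<partial>P) = (\<integral>\<omega>. f \<omega> \<partial>P)"
  using assms integral_distr[OF T_measurable, of f] T_preserves by auto

lemma integrable_max_sum: "integrable P G \<Longrightarrow> integrable P (max_sum T G n)"
proof (induction n)
  case (Suc n)
  then have "integrable P (\<lambda>\<omega>. max_sum T G n (T \<omega>))"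
    by (intro integrable_comp_T) auto
  then have "integrable P (\<lambda>\<omega>. max 0 (G \<omega> + max_sum T G n (T \<omega>)))"
    by (intro integrable_max Bochner_Integration.integrable_add Suc.prems) auto
  then show ?case by simp
next
  case 0
  have "max_sum T G 0 = (\<lambda>\<omega>. 0)" by (simp add: fun_eq_iff)
  then show ?case by simp
qed

text \<open>Garsia's argument: \<open>max_sum \<omega> - max_sum (T \<omega>) \<le> G \<omega>\<close> wherever \<open>max_sum\<close> is positive,
  and the left-hand side integrates to zero.\<close>

lemma integral_nonneg_of_positive_sums:
  assumes G: "integrable P G" and pos: "AE \<omega> in P. \<exists>n. birkhoff_sum T G n \<omega> > 0"
  shows "(\<integral>\<omega>. G \<omega> \<partial>P) \<ge> 0"
proof -
  let ?I = "\<lambda>n \<omega>. G \<omega> * indicator {\<omega>. max_sum T G (Suc n) \<omega> > 0} \<omega>"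
  have [measurable]: "G \<in> borel_measurable P" using G by auto
  have ms[measurable]: "max_sum T G n \<in> borel_measurable P" for n
    using integrable_max_sum[OF G] by auto
  have Im: "?I n \<in> borel_measurable P" for n
  proof -
    have "?I n = (\<lambda>\<omega>. if max_sum T G (Suc n) \<omega> > 0 then G \<omega> else 0)"
      by (auto simp: fun_eq_iff indicator_def)
    moreover have "\<dots> \<in> borel_measurable P" by (simp del: max_sum.simps)
    ultimately show ?thesis by simp
  qed
  have Iint: "integrable P (?I n)" for n
    by (rule Bochner_Integration.integrable_bound[OF G Im]) (auto simp: indicator_def)
  have nonneg: "(\<integral>\<omega>. ?I n \<omega> \<partial>P) \<ge> 0" for n
  proof -
    let ?m = "max_sum T G (Suc n)"
    have i: "integrable P ?m" by (rule integrable_max_sum[OF G])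
    have "0 = (\<integral>\<omega>. ?m \<omega> - ?m (T \<omega>) \<partial>P)"
      by (subst Bochner_Integration.integral_diff[OF i integrable_comp_T[OF i]])
         (simp only: integral_comp_T[OF i] diff_self)
    also have "\<dots> \<le> (\<integral>\<omega>. ?I n \<omega> \<partial>P)"
    proof (rule integral_mono[OF _ Iint])
      show "integrable P (\<lambda>\<omega>. ?m \<omega> - ?m (T \<omega>))"
        by (intro Bochner_Integration.integrable_diff i integrable_comp_T)
      fix \<omega>
      have a: "max_sum T G n (T \<omega>) \<le> ?m (T \<omega>)" by (rule max_sum_mono_Suc)
      have b: "?m \<omega> = max 0 (G \<omega> + max_sum T G n (T \<omega>))" by simp
      have c: "?m (T \<omega>) \<ge> 0" by simp
      \<comment> \<open>Where \<open>?m \<omega>\<close> is positive it equals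
        \<open>G \<omega> + max_sum T G n (T \<omega>)\<close>, which is at most
        \<open>G \<omega> + ?m (T \<omega>)\<close>; elsewhere \<open>?m \<omega>\<close> is 0 and
        the left side is at most 0.\<close>
      show "?m \<omega> - ?m (T \<omega>) \<le> ?I n \<omega>"
        using a b c by (auto simp: indicator_def simp del: max_sum.simps)
    qed
    finally show ?thesis .
  qed
  \<comment> \<open>By \<open>pos\<close> and monotonicity in \<open>n\<close>, almost every point
    eventually stays in the indicator set, so the indicators disappear in the limit.\<close>
  have "(\<lambda>n. \<integral>\<omega>. ?I n \<omega> \<partial>P) \<longlonglongrightarrow> (\<integral>\<omega>. G \<omega> \<partial>P)"
  proof (rule integral_dominated_convergence[where w = "\<lambda>\<omega>. \<bar>G \<omega>\<bar>"])
    show "AE \<omega> in P. (\<lambda>n. ?I n \<omega>) \<longlonglongrightarrow> G \<omega>"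
      using pos
    proof eventually_elim
      case (elim \<omega>)
      then obtain n where n: "birkhoff_sum T G n \<omega> > 0" by auto
      have "max_sum T G (Suc m) \<omega> > 0" if "m \<ge> n" for m
        using n birkhoff_sum_le_max_sum[where G = G and T = T and n = n and \<omega> = \<omega>] max_sum_mono[where T = T and G = G and \<omega> = \<omega>, of n "Suc m"] that
        by (simp del: max_sum.simps)
      then have "eventually (\<lambda>m. ?I m \<omega> = G \<omega>) sequentially"
        by (intro eventually_sequentiallyI[of n]) (auto simp: indicator_def simp del: max_sum.simps)
      then show ?case by (rule tendsto_eventually)
    qed
  qed (use G Im in \<open>auto simp: indicator_def\<close>)
  then show ?thesis
    by (rule LIMSEQ_le_const) (use nonneg in auto)
qed

text \<open>If the sums exceeded every bound \<open>B + c * n\<close> almost surely, those of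
  \<open>F - c\<close> would become positive almost surely, and Garsia's inequality would force the
  mean of \<open>F\<close> up to \<open>c\<close>.\<close>

lemma birkhoff_sum_upper:
  assumes F: "integrable P F" and c: "(\<integral>\<omega>. F \<omega> \<partial>P) < c"
  shows "AE \<omega> in P. \<exists>B. \<forall>n. birkhoff_sum T F n \<omega> \<le> B + c * real n"
proof -
  have [measurable]: "F \<in> borel_measurable P" using F by auto
  \<comment> \<open>Unboundedness of \<open>S n - c n\<close> is strictly shift-invariant, so the 0-1 law applies to it as stated.\<close>
  define A where "A = {\<omega>\<in>space P. \<forall>B::nat. \<exists>n. birkhoff_sum T F n \<omega> - c * real n > real B}"
  have A: "A \<in> sets P" unfolding A_def by measurable
  \<comment> \<open>Moving the starting point changes the centred sum by
    \<open>c - F \<omega>\<close>, an amount independent of \<open>n\<close>, which a larger bound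
    \<open>B'\<close> absorbs.\<close>
  have shift: "birkhoff_sum T F n (T \<omega>) - c * real n =
      birkhoff_sum T F (Suc n) \<omega> - c * real (Suc n) + (c - F \<omega>)" for n \<omega>
    unfolding birkhoff_sum_Suc_shift by (simp add: algebra_simps)
  have TA: "T \<omega> \<in> A \<longleftrightarrow> \<omega> \<in> A" if w: "\<omega> \<in> space P" for \<omega>
  proof
    assume "T \<omega> \<in> A"
    show "\<omega> \<in> A" unfolding A_def
    proof (safe intro!: w)
      fix B :: nat
      obtain B' :: nat where B': "real B + \<bar>c - F \<omega>\<bar> \<le> real B'" using real_arch_simple by blast
      obtain n where "birkhoff_sum T F n (T \<omega>) - c * real n > real B'"
        using \<open>T \<omega> \<in> A\<close> unfolding A_def by auto
      then show "\<exists>n. birkhoff_sum T F n \<omega> - c * real n > real B"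
        unfolding shift using B' by (intro exI[of _ "Suc n"]) linarith
    qed
  next
    assume "\<omega> \<in> A"
    show "T \<omega> \<in> A" unfolding A_def
    proof (safe)
      show "T \<omega> \<in> space P" using w by (meson T_measurable measurable_space)
      fix B :: nat
      obtain B' :: nat where B': "real B + \<bar>c - F \<omega>\<bar> \<le> real B'" using real_arch_simple by blast
      obtain n where n: "birkhoff_sum T F n \<omega> - c * real n > real B'"
        using \<open>\<omega> \<in> A\<close> unfolding A_def by auto
      \<comment> \<open>The empty sum is 0 and cannot exceed \<open>B'\<close>, so \<open>n\<close>
        has a predecessor.\<close>
      then have "n \<noteq> 0" by (intro notI) simp
      then obtain m where m: "n = Suc m" using not0_implies_Suc by blast
      from n[unfolded m] B' show "\<exists>n. birkhoff_sum T F n (T \<omega>) - c * real n > real B"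
        unfolding shift by (intro exI[of _ m]) linarith
    qed
  qed
  have "T -` A \<inter> space P = A"
    using TA A_def by auto
  from T_ergodic[OF A this] have "prob A = 0"
  proof
    assume "prob A = 1"
    then have "AE \<omega> in P. \<omega> \<in> A"
      using A by (simp add: AE_in_set_eq_1)
    then have "AE \<omega> in P. \<exists>n. birkhoff_sum T (\<lambda>\<omega>. F \<omega> - c) n \<omega> > 0"
    proof eventually_elim
      case (elim \<omega>)
      then obtain n where "birkhoff_sum T F n \<omega> - c * real n > real 0"
        unfolding A_def by blast
      then show ?case by (intro exI[of _ n]) (simp add: sum_subtractf mult.commute)
    qed
    from integral_nonneg_of_positive_sums[OF _ this] F c
    show ?thesis by (simp add: prob_space)
  qed
  then have "AE \<omega> in P. \<omega> \<notin> A"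
    using A by (subst AE_iff_measurable[of A]) (auto simp: A_def emeasure_eq_measure)
  then show ?thesis
    using AE_space
  proof eventually_elim
    case (elim \<omega>)
    then obtain B :: nat where "\<not> (\<exists>n. birkhoff_sum T F n \<omega> - c * real n > real B)"
      unfolding A_def by blast
    then show ?case by (intro exI[of _ "real B"]) (auto simp: not_less algebra_simps)
  qed
qed

text \<open>Linear upper bounds with slopes just above the mean, for \<open>F\<close> and for
  \<open>- F\<close>, squeeze the average once the additive constants are divided by
  \<open>n\<close>. Taking only the slopes with excess \<open>?d m\<close> keeps the exceptional set
  null.\<close>

theorem birkhoff:
  assumes F: "integrable P F"
  shows "AE \<omega> in P. (\<lambda>n. birkhoff_sum T F n \<omega> / real n) \<longlonglongrightarrow> (\<integral>\<omega>. F \<omega> \<partial>P)"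
proof -
  let ?e = "\<integral>\<omega>. F \<omega> \<partial>P"
  let ?d = "\<lambda>m::nat. inverse (real (Suc m))"
  have "AE \<omega> in P. \<forall>m. \<exists>B. \<forall>n. birkhoff_sum T F n \<omega> \<le> B + (?e + ?d m) * real n"
    unfolding AE_all_countable by (intro allI birkhoff_sum_upper F) simp
  moreover have "AE \<omega> in P. \<forall>m. \<exists>B. \<forall>n. birkhoff_sum T (\<lambda>\<omega>. - F \<omega>) n \<omega> \<le> B + (- ?e + ?d m) * real n"
    unfolding AE_all_countable by (intro allI birkhoff_sum_upper) (use F in auto)
  ultimately show ?thesis
  proof eventually_elim
    case (elim \<omega>)
    show ?case
    proof (rule LIMSEQ_I)
      fix \<epsilon> :: real assume "\<epsilon> > 0"
      then obtain m where m: "?d m < \<epsilon> / 2" using reals_Archimedean[of "\<epsilon>/2"] by auto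
      obtain B1 where B1: "\<And>n. birkhoff_sum T F n \<omega> \<le> B1 + (?e + ?d m) * real n"
        using elim(1) by blast
      obtain B2 where B2: "\<And>n. - birkhoff_sum T F n \<omega> \<le> B2 + (- ?e + ?d m) * real n"
        using elim(2) by (auto simp: sum_negf)
      \<comment> \<open>Beyond \<open>n0\<close> the additive constants cost at most
        \<open>\<epsilon> / 2\<close> per step; the excess \<open>?d m\<close> of the slope costs
        less than the other half.\<close>
      obtain n0 :: nat where n0: "max (max B1 B2) 0 / (\<epsilon> / 2) \<le> real n0"
        using real_arch_simple by blast
      show "\<exists>n0. \<forall>n\<ge>n0. norm (birkhoff_sum T F n \<omega> / real n - ?e) < \<epsilon>"
      proof (intro exI[of _ "Suc n0"] allI impI)
        fix n assume n: "n \<ge> Suc n0"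
        then have np: "real n > 0" by simp
        have "max (max B1 B2) 0 \<le> \<epsilon> / 2 * real n0"
          using n0 \<open>\<epsilon> > 0\<close> by (simp add: divide_le_eq mult.commute)
        also have "\<dots> \<le> \<epsilon> / 2 * real n" using n \<open>\<epsilon> > 0\<close> by simp
        finally have Bn: "B1 \<le> \<epsilon> / 2 * real n" "B2 \<le> \<epsilon> / 2 * real n" by auto
        have dn: "?d m * real n < \<epsilon> / 2 * real n" using m np by (rule mult_strict_right_mono)
        have "\<bar>birkhoff_sum T F n \<omega> - ?e * real n\<bar> < \<epsilon> * real n"
          using B1[of n] B2[of n] Bn dn by (simp add: distrib_right left_diff_distrib abs_less_iff del: of_nat_Suc)
        then show "norm (birkhoff_sum T F n \<omega> / real n - ?e) < \<epsilon>"
          using np by (simp add: divide_less_eq abs_less_iff field_simps)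
      qed
    qed
  qed
qed

end

section \<open>Stationary ergodic processes\<close>

lemma measurable_process_path:
  assumes "\<And>i. Z i \<in> borel_measurable M"
  shows "(\<lambda>\<omega> i. Z i \<omega>) \<in> measurable M (path_space borel)"
  unfolding path_space_def by (rule measurable_PiM_single') (use assms in auto)

lemma measurable_path_shift:
  "(\<lambda>\<omega> i. \<omega> (Suc i)) \<in> measurable (path_space B) (path_space B)"
  unfolding path_space_def
  by (rule measurable_PiM_single') (auto simp: space_PiM PiE_def Pi_def)

lemma measurable_path_component:
  "(\<lambda>\<omega>. \<omega> i) \<in> measurable (path_space B) B"
  unfolding path_space_def by simp

lemma stationary_process_measurable: "stationary_process M Z \<Longrightarrow> Z i \<in> borel_measurable M"
  unfolding stationary_process_def by blast

text \<open>\<open>M\<close> carries no transformation, so the dynamics are moved to path space,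
  where stationarity with lag 1 says that the shift preserves the law.\<close>

lemma ergodic_pmp_path_law:
  fixes Z :: "nat \<Rightarrow> 'm \<Rightarrow> 'b::topological_space"
  assumes M: "prob_space M" and S: "stationary_process M Z" and E: "ergodic_process M Z"
  shows "ergodic_pmp (path_law M Z) (\<lambda>\<omega> i. \<omega> (Suc i))"
proof -
  have Z: "(\<lambda>\<omega> i. Z i \<omega>) \<in> measurable M (path_space borel)"
    by (rule measurable_process_path) (rule stationary_process_measurable[OF S])
  interpret prob_space M by fact
  interpret P: prob_space "path_law M Z"
    unfolding path_law_def by (rule prob_space_distr[OF Z])
  have sets: "sets (path_law M Z) = sets (path_space borel)"
    by (simp add: path_law_def)
  note T = measurable_path_shift[of borel]
  show ?thesis
  proof
    show "(\<lambda>\<omega> i. \<omega> (Suc i)) \<in> measurable (path_law M Z) (path_law M Z)"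
      using T measurable_cong_sets[OF sets sets] by blast
    have "distr (path_law M Z) (path_law M Z) (\<lambda>\<omega> i. \<omega> (Suc i)) =
        distr (path_law M Z) (path_space borel) (\<lambda>\<omega> i. \<omega> (Suc i))"
      by (rule distr_cong) (use sets in auto)
    also have "\<dots> = path_law M (\<lambda>i. Z (i + 1))"
      unfolding path_law_def by (subst distr_distr[OF T Z]) (simp add: comp_def)
    also have "\<dots> = path_law M Z"
      using S unfolding stationary_process_def by blast
    finally show "distr (path_law M Z) (path_law M Z) (\<lambda>\<omega> i. \<omega> (Suc i)) = path_law M Z" .
    show "P.prob A = 0 \<or> P.prob A = 1"
      if "A \<in> sets (path_law M Z)" "(\<lambda>\<omega> i. \<omega> (Suc i)) -` A \<inter> space (path_law M Z) = A" for A
      using E that unfolding ergodic_process_def sets by (auto simp: path_law_def)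
  qed
qed

lemma funpow_path_shift: "((\<lambda>\<omega> i. \<omega> (Suc i)) ^^ n) \<omega> = (\<lambda>i. \<omega> (i + n))"
  by (induction n) (auto simp: fun_eq_iff)

text \<open>This is \<open>birkhoff\<close> for the observable that reads coordinate 0, since the
  \<open>i\<close>-th shift makes it read coordinate \<open>i\<close>. The result is pulled back
  along the path map.\<close>

theorem ergodic_process_average:
  fixes f :: "'b::topological_space \<Rightarrow> real" and Z :: "nat \<Rightarrow> 'm \<Rightarrow> 'b"
  assumes M: "prob_space M" and S: "stationary_process M Z" and E: "ergodic_process M Z"
    and f [measurable]: "f \<in> borel_measurable borel" and I: "integrable M (\<lambda>\<omega>. f (Z 0 \<omega>))"
  shows "AE \<omega> in M. (\<lambda>n. (\<Sum>j<n. f (Z j \<omega>)) / real n) \<longlonglongrightarrow> (\<integral>\<omega>. f (Z 0 \<omega>) \<partial>M)"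
proof -
  interpret ergodic_pmp "path_law M Z" "\<lambda>\<omega> i. \<omega> (Suc i)"
    by (rule ergodic_pmp_path_law[OF M S E])
  have Z: "(\<lambda>\<omega> i. Z i \<omega>) \<in> measurable M (path_space borel)"
    by (rule measurable_process_path) (rule stationary_process_measurable[OF S])
  have fm: "(\<lambda>\<omega>. f (\<omega> 0)) \<in> borel_measurable (path_space borel)"
    by (rule measurable_compose[OF measurable_path_component f])
  have "integrable (path_law M Z) (\<lambda>\<omega>. f (\<omega> 0))"
    unfolding path_law_def using I integrable_distr_eq[OF Z fm] by simp
  from birkhoff[OF this]
  have "AE \<omega> in distr M (path_space borel) (\<lambda>\<omega> i. Z i \<omega>).
      (\<lambda>n. (\<Sum>j<n. f (\<omega> j)) / real n) \<longlonglongrightarrow> (\<integral>\<omega>. f (Z 0 \<omega>) \<partial>M)"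
    unfolding path_law_def integral_distr[OF Z fm] funpow_path_shift add_0 .
  from AE_distrD[OF Z this] show ?thesis .
qed

text \<open>Every shifted path law is the original one, and countably many times can be combined. It
  serves to turn a bound on \<open>Y 0\<close> into a bound on the whole sample.\<close>

lemma stationary_process_AE:
  assumes S: "stationary_process M Z" and P: "{z. P z} \<in> sets borel"
    and AE0: "AE \<omega> in M. P (Z 0 \<omega>)"
  shows "AE \<omega> in M. \<forall>j. P (Z j \<omega>)"
proof -
  have Z: "(\<lambda>\<omega> i. Z (i + k) \<omega>) \<in> measurable M (path_space borel)" for k
    by (rule measurable_process_path) (rule stationary_process_measurable[OF S])
  have set: "{\<omega> \<in> space (path_space borel). P (\<omega> 0)} \<in> sets (path_space borel)"
    using measurable_sets[OF measurable_path_component P, of 0] by (simp add: vimage_def Int_def conj_commute)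
  have "AE \<omega> in path_law M (\<lambda>i. Z (i + 0)). P (\<omega> 0)"
    unfolding path_law_def using AE0 by (subst AE_distr_iff[OF Z set]) simp
  moreover have eq: "path_law M (\<lambda>i. Z (i + 0)) = path_law M (\<lambda>i. Z (i + k))" for k
    using S unfolding stationary_process_def by (blast intro: trans sym)
  ultimately have "AE \<omega> in path_law M (\<lambda>i. Z (i + k)). P (\<omega> 0)" for k
    unfolding eq[of k, symmetric] by blast
  then have "AE \<omega> in M. P (Z (0 + k) \<omega>)" for k
    unfolding path_law_def by (subst (asm) AE_distr_iff[OF Z set])
  then show ?thesis unfolding AE_all_countable by simp
qed

section \<open>Uniform limits\<close>

text \<open>Finitely many points of \<open>D\<close> form a net for \<open>C\<close>, and
  equicontinuity carries the convergence from the net to \<open>C\<close>. Net points may lie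
  outside \<open>C\<close>, so the moduli range over the whole space; for \<open>F n\<close> they
  hold only eventually, because they will come from random averages.\<close>

lemma uniform_limit_of_dense:
  fixes F :: "nat \<Rightarrow> 'a::metric_space \<Rightarrow> real"
  assumes dense: "\<And>U. open U \<Longrightarrow> U \<noteq> {} \<Longrightarrow> \<exists>d\<in>D. d \<in> U"
    and conv: "\<And>d. d \<in> D \<Longrightarrow> (\<lambda>n. F n d) \<longlonglongrightarrow> G d"
    and equi: "\<And>\<epsilon>. \<epsilon> > 0 \<Longrightarrow> \<exists>\<delta>>0.
        (\<forall>\<^sub>F n in sequentially. \<forall>x x'. dist x x' < \<delta> \<longrightarrow> \<bar>F n x - F n x'\<bar> \<le> \<epsilon>) \<and>
        (\<forall>x x'. dist x x' < \<delta> \<longrightarrow> \<bar>G x - G x'\<bar> \<le> \<epsilon>)"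
    and C: "compact C"
  shows "uniform_limit C F G sequentially"
proof (rule uniform_limitI)
  fix \<epsilon> :: real assume "\<epsilon> > 0"
  then obtain \<delta> where \<delta>: "\<delta> > 0"
    and eF: "\<forall>\<^sub>F n in sequentially. \<forall>x x'. dist x x' < \<delta> \<longrightarrow> \<bar>F n x - F n x'\<bar> \<le> \<epsilon> / 4"
    and eG: "\<forall>x x'. dist x x' < \<delta> \<longrightarrow> \<bar>G x - G x'\<bar> \<le> \<epsilon> / 4"
    using equi[of "\<epsilon> / 4"] by auto
  have "C \<subseteq> (\<Union>d\<in>D. ball d \<delta>)"
  proof
    fix x
    obtain d where "d \<in> D" "d \<in> ball x \<delta>" using dense[of "ball x \<delta>"] \<delta> by auto
    then show "x \<in> (\<Union>d\<in>D. ball d \<delta>)" by (auto simp: dist_commute)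
  qed
  then obtain D' where D': "D' \<subseteq> D" "finite D'" "C \<subseteq> (\<Union>d\<in>D'. ball d \<delta>)"
    using compactE_image[OF C, of D "\<lambda>d. ball d \<delta>"] by auto
  have "\<forall>\<^sub>F n in sequentially. \<forall>d\<in>D'. dist (F n d) (G d) < \<epsilon> / 4"
    using D' conv \<open>\<epsilon> > 0\<close> by (intro eventually_ball_finite ballI tendstoD) auto
  with eF show "\<forall>\<^sub>F n in sequentially. \<forall>x\<in>C. dist (F n x) (G x) < \<epsilon>"
  proof eventually_elim
    case (elim n)
    show ?case
    proof
      fix x assume "x \<in> C"
      then obtain d where d: "d \<in> D'" "dist d x < \<delta>" using D' by auto
      then have "\<bar>F n d - F n x\<bar> \<le> \<epsilon> / 4" "\<bar>G d - G x\<bar> \<le> \<epsilon> / 4" "\<bar>F n d - G d\<bar> < \<epsilon> / 4"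
        using elim eG by (auto simp: dist_real_def)
      then show "dist (F n x) (G x) < \<epsilon>" unfolding dist_real_def by linarith
    qed
  qed
qed

text \<open>The dominating series makes both tails beyond some \<open>m\<close> smaller than
  \<open>\<epsilon> / 3\<close>, uniformly in \<open>n\<close> and \<open>x\<close>; a finite sum of
  uniform limits remains.\<close>

lemma uniform_limit_suminf_dominated:
  fixes f :: "'n \<Rightarrow> nat \<Rightarrow> 'x \<Rightarrow> real"
  assumes lim: "\<And>j. uniform_limit C (\<lambda>n. f n j) (g j) F"
    and f: "\<And>n j x. \<bar>f n j x\<bar> \<le> a j" and g: "\<And>j x. \<bar>g j x\<bar> \<le> a j" and a: "summable a"
  shows "uniform_limit C (\<lambda>n x. \<Sum>j. f n j x) (\<lambda>x. \<Sum>j. g j x) F"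
proof (rule uniform_limitI)
  fix \<epsilon> :: real assume "\<epsilon> > 0"
  then obtain m where m: "\<bar>\<Sum>j. a (j + m)\<bar> < \<epsilon> / 3"
    using suminf_exist_split[of "\<epsilon> / 3" a] a by auto
  have sa: "summable (\<lambda>j. a (j + m))" using a by (rule summable_ignore_initial_segment)
  have tail: "summable h \<and> \<bar>(\<Sum>j. h (j + m))\<bar> < \<epsilon> / 3" if h: "\<And>j. \<bar>h j\<bar> \<le> a j" for h :: "nat \<Rightarrow> real"
  proof
    show "summable h" using h by (intro summable_comparison_test'[OF a, of 0]) auto
    have ah: "summable (\<lambda>j. \<bar>h (j + m)\<bar>)"
      using h by (intro summable_comparison_test'[OF sa, of 0]) auto
    have "\<bar>\<Sum>j. h (j + m)\<bar> \<le> (\<Sum>j. \<bar>h (j + m)\<bar>)" by (rule summable_rabs[OF ah])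
    also have "\<dots> \<le> (\<Sum>j. a (j + m))" using h ah sa by (intro suminf_le) auto
    finally show "\<bar>\<Sum>j. h (j + m)\<bar> < \<epsilon> / 3" using m by linarith
  qed
  have "uniform_limit C (\<lambda>n x. \<Sum>j<m. f n j x) (\<lambda>x. \<Sum>j<m. g j x) F"
    by (induction m) (auto intro!: uniform_limit_add uniform_limit_const lim)
  then have "\<forall>\<^sub>F n in F. \<forall>x\<in>C. dist (\<Sum>j<m. f n j x) (\<Sum>j<m. g j x) < \<epsilon> / 3"
    by (rule uniform_limitD) (use \<open>\<epsilon> > 0\<close> in simp)
  then show "\<forall>\<^sub>F n in F. \<forall>x\<in>C. dist (\<Sum>j. f n j x) (\<Sum>j. g j x) < \<epsilon>"
  proof eventually_elim
    case (elim n)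
    show ?case
    proof
      fix x assume "x \<in> C"
      then have 1: "\<bar>(\<Sum>j<m. f n j x) - (\<Sum>j<m. g j x)\<bar> < \<epsilon> / 3"
        using elim by (auto simp: dist_real_def)
      have 2: "\<bar>\<Sum>j. f n (j + m) x\<bar> < \<epsilon> / 3" and 3: "\<bar>\<Sum>j. g (j + m) x\<bar> < \<epsilon> / 3"
        and 4: "summable (\<lambda>j. f n j x)" and 5: "summable (\<lambda>j. g j x)"
        using tail[of "\<lambda>j. f n j x"] tail[of "\<lambda>j. g j x"] f g by auto
      show "dist (\<Sum>j. f n j x) (\<Sum>j. g j x) < \<epsilon>"
        unfolding suminf_split_initial_segment[OF 4, of m] suminf_split_initial_segment[OF 5, of m]
        using 1 2 3 unfolding dist_real_def by linarith
    qed
  qed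
qed

text \<open>Closeness within \<open>\<epsilon> / 2\<close> keeps the supremum strictly below
  \<open>\<epsilon>\<close>. Nonemptiness of \<open>C\<close> enters both the upper and the lower
  bound of the supremum.\<close>

lemma SUP_tendsto_0:
  assumes C: "C \<noteq> {}" and lim: "uniform_limit C f (g :: 'x \<Rightarrow> real) F"
  shows "((\<lambda>n. SUP x\<in>C. \<bar>f n x - g x\<bar>) \<longlongrightarrow> 0) F"
proof (rule tendstoI)
  fix \<epsilon> :: real assume "\<epsilon> > 0"
  then have "\<forall>\<^sub>F n in F. \<forall>x\<in>C. dist (f n x) (g x) < \<epsilon> / 2"
    by (intro uniform_limitD[OF lim]) simp
  then show "\<forall>\<^sub>F n in F. dist (SUP x\<in>C. \<bar>f n x - g x\<bar>) 0 < \<epsilon>"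
  proof eventually_elim
    case (elim n)
    then have le: "\<bar>f n x - g x\<bar> \<le> \<epsilon> / 2" if "x \<in> C" for x
      using that by (auto simp: dist_real_def intro: less_imp_le)
    then have "(SUP x\<in>C. \<bar>f n x - g x\<bar>) \<le> \<epsilon> / 2" by (intro cSUP_least C)
    moreover have "0 \<le> (SUP x\<in>C. \<bar>f n x - g x\<bar>)"
    proof -
      obtain x where "x \<in> C" using C by blast
      have "bdd_above ((\<lambda>x. \<bar>f n x - g x\<bar>) ` C)" using le by (intro bdd_aboveI2[where M = "\<epsilon> / 2"]) auto
      from cSUP_upper[OF \<open>x \<in> C\<close> this] show ?thesis by (meson abs_ge_zero order_trans)
    qed
    ultimately show ?case using \<open>\<epsilon> > 0\<close> by (simp add: dist_real_def)
  qed
qed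

text \<open>The total mass is 1, so a uniform error \<open>\<epsilon>\<close> on \<open>C\<close>
  gives an integral of at most the square of \<open>\<epsilon>\<close>.\<close>

lemma nn_integral_tendsto_0_of_uniform_limit:
  assumes \<nu>: "prob_space \<nu>" and C: "AE x in \<nu>. x \<in> C" and lim: "uniform_limit C f (g :: 'x \<Rightarrow> real) sequentially"
  shows "(\<lambda>n. \<integral>\<^sup>+x. ennreal ((f n x - g x)\<^sup>2) \<partial>\<nu>) \<longlonglongrightarrow> 0"
proof -
  interpret V: prob_space \<nu> by fact
  have bound: "\<forall>\<^sub>F n in sequentially. (\<integral>\<^sup>+x. ennreal ((f n x - g x)\<^sup>2) \<partial>\<nu>) \<le> ennreal (\<epsilon>\<^sup>2)" if "\<epsilon> > 0" for \<epsilon>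
    using uniform_limitD[OF lim that]
  proof eventually_elim
    case (elim n)
    have sq: "(f n x - g x)\<^sup>2 \<le> \<epsilon>\<^sup>2" if "x \<in> C" for x
    proof -
      have "\<bar>f n x - g x\<bar> \<le> \<epsilon>" using elim that by (auto simp: dist_real_def less_imp_le)
      then show ?thesis by (metis abs_ge_zero power2_abs power_mono)
    qed
    have "(\<integral>\<^sup>+x. ennreal ((f n x - g x)\<^sup>2) \<partial>\<nu>) \<le> (\<integral>\<^sup>+x. ennreal (\<epsilon>\<^sup>2) \<partial>\<nu>)"
      by (rule nn_integral_mono_AE) (rule eventually_mono[OF C], rule ennreal_leI, rule sq)
    then show ?case by (simp add: V.emeasure_space_1)
  qed
  show ?thesis
  proof (rule order_tendstoI)
    fix a :: ennreal assume "0 < a"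
    \<comment> \<open>\<open>bound\<close> yields only a weak inequality; the intermediate
      \<open>c\<close> supplies the strict one.\<close>
    then obtain c where c: "0 < c" "c < a" using dense by blast
    have "\<exists>\<epsilon>>0. ennreal (\<epsilon>\<^sup>2) \<le> c"
    proof (cases c)
      case (real y)
      then show ?thesis using c by (intro exI[of _ "sqrt y"]) (auto simp: ennreal_less_zero_iff)
    next
      case top
      then show ?thesis by (intro exI[of _ 1]) auto
    qed
    then obtain \<epsilon> where "\<epsilon> > 0" "ennreal (\<epsilon>\<^sup>2) \<le> c" by blast
    with bound[of \<epsilon>] c show "\<forall>\<^sub>F n in sequentially. (\<integral>\<^sup>+x. ennreal ((f n x - g x)\<^sup>2) \<partial>\<nu>) < a"
      by (auto elim!: eventually_mono)
  qed auto
qed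

section \<open>Clipping and the support of a measure\<close>

lemma hbw_pos [simp]: "hbw k > 0"
  by (simp add: hbw_def)

text \<open>\<open>clip\<close> is the projection onto an interval symmetric about 0. Its bound, its
  Lipschitz property and its measurability can be read off this form.\<close>

lemma clip_eq:
  assumes "L \<ge> 0"
  shows "clip L k a = max (- (L * 2 powr (- real k))) (min a (L * 2 powr (- real k)))"
proof -
  have "L * 2 powr (- real k) \<ge> 0" using assms by simp
  then show ?thesis unfolding clip_def
    by (cases a "0::real" rule: linorder_cases) (auto simp only: sgn_pos sgn_neg sgn_zero min_def max_def abs_of_pos abs_of_neg split: if_splits)
qed

lemma abs_clip_le:
  assumes "L \<ge> 0" shows "\<bar>clip L k a\<bar> \<le> L * 2 powr (- real k)"
proof -
  have "L * 2 powr (- real k) \<ge> 0" using assms by simp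
  then show ?thesis unfolding clip_eq[OF assms] by linarith
qed

lemma dist_clip_le: "L \<ge> 0 \<Longrightarrow> dist (clip L k a) (clip L k a') \<le> dist a a'"
  by (simp add: clip_eq dist_real_def max_def min_def)

lemma uniform_limit_clip:
  assumes "uniform_limit C f g F" "L \<ge> 0"
  shows "uniform_limit C (\<lambda>n x. clip L k (f n x)) (\<lambda>x. clip L k (g x)) F"
proof (rule uniform_limitI)
  fix \<epsilon> :: real assume "\<epsilon> > 0"
  from uniform_limitD[OF assms(1) this]
  show "\<forall>\<^sub>F n in F. \<forall>x\<in>C. dist (clip L k (f n x)) (clip L k (g x)) < \<epsilon>"
    by eventually_elim (meson assms(2) dist_clip_le order_le_less_trans)
qed

text \<open>If the closed ball of radius \<open>1 / k\<close> about \<open>x\<close> is null, so is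
  the ball of half that radius about any point closer than half that radius.\<close>

lemma closed_supp: "closed (supp \<mu>)" if "finite_measure \<mu>" "sets \<mu> = sets borel"
proof -
  interpret finite_measure \<mu> by fact
  have "open (- supp \<mu>)"
  proof (rule openI)
    fix x assume "x \<in> - supp \<mu>"
    then obtain k :: nat where k: "k \<ge> 1" "measure \<mu> (cball x (1 / real k)) = 0"
      by (auto simp: supp_def not_less measure_le_0_iff)
    have "y \<notin> supp \<mu>" if "dist x y < 1 / real (2 * k)" for y
    proof
      assume "y \<in> supp \<mu>"
      then have "measure \<mu> (cball y (1 / real (2 * k))) > 0"
        using k unfolding supp_def by (auto dest!: spec[of _ "2 * k"])
      also have "measure \<mu> (cball y (1 / real (2 * k))) \<le> measure \<mu> (cball x (1 / real k))"
      proof (rule finite_measure_mono)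
        show "cball y (1 / real (2 * k)) \<subseteq> cball x (1 / real k)"
        proof
          fix z assume "z \<in> cball y (1 / real (2 * k))"
          then have "dist x z \<le> 1 / real (2 * k) + 1 / real (2 * k)"
            using that dist_triangle[of x z y] by auto
          also have "\<dots> = 1 / real k" using k by (simp add: field_simps)
          finally show "z \<in> cball x (1 / real k)" by simp
        qed
      qed (use \<open>sets \<mu> = sets borel\<close> in auto)
      finally show False using k by simp
    qed
    then show "\<exists>e>0. ball x e \<subseteq> - supp \<mu>"
      using k by (intro exI[of _ "1 / real (2 * k)"]) auto
  qed
  then show ?thesis by (simp add: closed_def)
qed

text \<open>Every point off the support has a null ball, and by Lindelof countably many such balls
  cover the complement.\<close>

lemma AE_in_supp:
  fixes \<mu> :: "'a::{metric_space, second_countable_topology} measure"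
  assumes fin: "finite_measure \<mu>" and sets: "sets \<mu> = sets borel"
  shows "AE x in \<mu>. x \<in> supp \<mu>"
proof -
  interpret finite_measure \<mu> by fact
  \<comment> \<open>The family consists of open balls, as Lindelof requires, while nullity is stated
    for the closed balls that \<open>supp\<close> tests.\<close>
  define \<F> where "\<F> = {ball x (1 / real k) | x k. k \<ge> 1 \<and> measure \<mu> (cball x (1 / real k)) = 0}"
  have "\<And>S. S \<in> \<F> \<Longrightarrow> open S" by (auto simp: \<F>_def)
  then obtain \<F>' where F': "\<F>' \<subseteq> \<F>" "countable \<F>'" "\<Union>\<F>' = \<Union>\<F>"
    using Lindelof by metis
  have null: "B \<in> null_sets \<mu>" if BF: "B \<in> \<F>'" for B
  proof -
    obtain x k where B: "B = ball x (1 / real k)" "measure \<mu> (cball x (1 / real k)) = 0"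
      using subsetD[OF F'(1) BF] unfolding \<F>_def by auto
    then have "cball x (1 / real k) \<in> null_sets \<mu>"
      using sets by (auto simp: null_sets_def emeasure_eq_measure)
    then show ?thesis
      by (rule null_sets_subset) (use B sets in auto)
  qed
  have "\<Union>\<F>' \<in> null_sets \<mu>"
    using null_sets_UN'[OF F'(2), of "\<lambda>B. B" \<mu>] null by auto
  then have "AE x in \<mu>. x \<notin> \<Union>\<F>'" by (rule AE_not_in)
  then show ?thesis
  proof eventually_elim
    case (elim x)
    show ?case
    proof (rule ccontr)
      assume "x \<notin> supp \<mu>"
      then obtain k :: nat where "k \<ge> 1" "measure \<mu> (cball x (1 / real k)) = 0"
        by (auto simp: supp_def not_less measure_le_0_iff)
      then have "ball x (1 / real k) \<in> \<F>" "x \<in> ball x (1 / real k)" unfolding \<F>_def by auto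
      then show False using elim F'(3) by blast
    qed
  qed
qed

section \<open>The kernel estimator\<close>

locale kernel_regression = prob_space M
  for M :: "'m measure"
    and X :: "nat \<Rightarrow> 'm \<Rightarrow> 'a::euclidean_space"
    and Y :: "nat \<Rightarrow> 'm \<Rightarrow> real"
    and K :: "'a \<Rightarrow> real"
    and b r L :: real
    and N :: "nat \<Rightarrow> nat" +
  assumes stationary: "stationary_process M (\<lambda>i \<omega>. (X i \<omega>, Y i \<omega>))"
    and ergodic: "ergodic_process M (\<lambda>i \<omega>. (X i \<omega>, Y i \<omega>))"
    and integrable_Y: "integrable M (Y 0)"
    and continuous_K: "continuous_on UNIV K"
    and b_pos: "0 < b" and r_pos: "0 < r"
    and K_lower: "\<And>x. b * indicator (cball 0 r) x \<le> K x"
    and K_upper: "\<And>x. K x \<le> indicator (cball 0 1) x"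
    and L_pos: "L > 0"
    and N_at_top: "filterlim N at_top sequentially"
begin

section \<open>The kernel and its modulus of continuity\<close>

abbreviation \<mu> :: "'a measure" where "\<mu> \<equiv> distr M borel (X 0)"

lemma measurable_X [measurable]: "X i \<in> borel_measurable M"
proof -
  have "(\<lambda>\<omega>. fst (X i \<omega>, Y i \<omega>)) \<in> borel_measurable M"
    by (rule measurable_compose[OF stationary_process_measurable[OF stationary]])
       (intro borel_measurable_continuous_onI continuous_intros)
  then show ?thesis by simp
qed

lemma measurable_K [measurable]: "K \<in> borel_measurable borel"
  by (rule borel_measurable_continuous_onI[OF continuous_K])

lemma K_nonneg: "K x \<ge> 0"
  using K_lower[of x] b_pos by (smt (verit) indicator_pos_le mult_nonneg_nonneg)

lemma K_le_1: "K x \<le> 1"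
  using K_upper[of x] by (smt (verit) indicator_le_1)

lemma K_eq_0: "norm x > 1 \<Longrightarrow> K x = 0"
  using K_upper[of x] K_nonneg[of x] by auto

lemma K_ge_b: "norm x \<le> r \<Longrightarrow> K x \<ge> b"
  using K_lower[of x] by auto

text \<open>\<open>K\<close> vanishes off the unit ball, so uniform continuity on the compact ball
  of radius 2 is enough.\<close>

lemma K_uniformly_continuous:
  assumes "\<epsilon> > 0"
  obtains \<delta> where "\<delta> > 0" "\<And>x y. dist x y < \<delta> \<Longrightarrow> \<bar>K x - K y\<bar> < \<epsilon>"
proof -
  have "uniformly_continuous_on (cball 0 2) K"
    by (intro compact_uniformly_continuous continuous_on_subset[OF continuous_K]) auto
  then obtain \<delta> where \<delta>: "\<delta> > 0"
    "\<And>x y. x \<in> cball 0 2 \<Longrightarrow> y \<in> cball 0 2 \<Longrightarrow> dist y x < \<delta> \<Longrightarrow> dist (K y) (K x) < \<epsilon>"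
    using assms unfolding uniformly_continuous_on_def by meson
  show ?thesis
  \<comment> \<open>Two points closer than 1 either both lie in the ball of radius 2 or both have
    norm above 1, where \<open>K\<close> is 0.\<close>
  proof (rule that[of "min \<delta> 1"])
    fix x y :: 'a assume d: "dist x y < min \<delta> 1"
    show "\<bar>K x - K y\<bar> < \<epsilon>"
    proof (cases "norm x \<le> 2 \<and> norm y \<le> 2")
      case True
      then show ?thesis using \<delta>(2)[of y x] d by (auto simp: dist_real_def)
    next
      case False
      then have "norm x > 1 \<and> norm y > 1"
        using d norm_triangle_ineq2[of x y] norm_triangle_ineq2[of y x]
        by (auto simp: dist_norm norm_minus_commute)
      then show ?thesis using assms by (simp add: K_eq_0)
    qed
  qed (use \<delta> in auto)
qed

abbreviation kern :: "nat \<Rightarrow> 'a \<Rightarrow> 'a \<Rightarrow> real" where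
  "kern k x u \<equiv> K ((1 / hbw k) *\<^sub>R (u - x))"

text \<open>One \<open>\<delta>\<close> serves all \<open>u\<close>: in the distance of the rescaled
  arguments \<open>u\<close> cancels, leaving the distance of the centres divided by
  \<open>hbw k\<close>.\<close>

lemma kern_equicontinuous:
  assumes "\<epsilon> > 0"
  obtains \<delta> where "\<delta> > 0" "\<And>x x' u. dist x x' < \<delta> \<Longrightarrow> \<bar>kern k x u - kern k x' u\<bar> < \<epsilon>"
proof -
  obtain \<delta> where \<delta>: "\<delta> > 0" "\<And>x y. dist x y < \<delta> \<Longrightarrow> \<bar>K x - K y\<bar> < \<epsilon>"
    using K_uniformly_continuous[OF assms] by blast
  show ?thesis
  proof (rule that[of "\<delta> * hbw k"])
    show "\<delta> * hbw k > 0" using \<delta> by simp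
    fix x x' u :: 'a assume d: "dist x x' < \<delta> * hbw k"
    have "dist ((1 / hbw k) *\<^sub>R (u - x)) ((1 / hbw k) *\<^sub>R (u - x')) = dist x x' / hbw k"
      unfolding dist_norm scaleR_diff_right[symmetric] norm_scaleR
      by (simp add: norm_minus_commute less_imp_le)
    also have "\<dots> < \<delta>" using d by (simp add: divide_less_eq)
    finally show "\<bar>kern k x u - kern k x' u\<bar> < \<epsilon>" by (rule \<delta>(2))
  qed
qed

section \<open>Kernel-weighted averages and their means\<close>

text \<open>The weight \<open>w\<close> will be \<open>snd\<close> for the numerator of
  \<open>Mhat\<close> and the constant 1 for its denominator, so one convergence proof covers both.
  Division by \<open>n\<close> makes each an ergodic average.\<close>

definition kavg :: "('a \<times> real \<Rightarrow> real) \<Rightarrow> nat \<Rightarrow> nat \<Rightarrow> 'm \<Rightarrow> 'a \<Rightarrow> real" where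
  "kavg w k n \<omega> x = (\<Sum>j<n. w (X j \<omega>, Y j \<omega>) * kern k x (X j \<omega>)) / real n"

definition kmean :: "('a \<times> real \<Rightarrow> real) \<Rightarrow> nat \<Rightarrow> 'a \<Rightarrow> real" where
  "kmean w k x = (\<integral>\<omega>. w (X 0 \<omega>, Y 0 \<omega>) * kern k x (X 0 \<omega>) \<partial>M)"

lemma integrable_kern:
  assumes "integrable M f"
  shows "integrable M (\<lambda>\<omega>. f \<omega> * kern k x (X 0 \<omega>))"
  using assms
proof (rule Bochner_Integration.integrable_bound)
  have [measurable]: "f \<in> borel_measurable M" using assms by auto
  show "(\<lambda>\<omega>. f \<omega> * kern k x (X 0 \<omega>)) \<in> borel_measurable M" by measurable
  show "AE \<omega> in M. norm (f \<omega> * kern k x (X 0 \<omega>)) \<le> norm (f \<omega>)"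
    by (intro AE_I2) (simp add: abs_mult K_nonneg K_le_1 mult_left_le)
qed

lemma kmean_equicontinuous:
  assumes w: "integrable M (\<lambda>\<omega>. w (X 0 \<omega>, Y 0 \<omega>))"
    and \<eta>: "\<And>u. \<bar>kern k x u - kern k x' u\<bar> \<le> \<eta>"
  shows "\<bar>kmean w k x - kmean w k x'\<bar> \<le> \<eta> * (\<integral>\<omega>. \<bar>w (X 0 \<omega>, Y 0 \<omega>)\<bar> \<partial>M)"
proof -
  let ?W = "\<lambda>\<omega>. w (X 0 \<omega>, Y 0 \<omega>)"
  have "kmean w k x - kmean w k x' = (\<integral>\<omega>. ?W \<omega> * kern k x (X 0 \<omega>) - ?W \<omega> * kern k x' (X 0 \<omega>) \<partial>M)"
    unfolding kmean_def by (simp add: integrable_kern[OF w])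
  also have "\<bar>\<dots>\<bar> \<le> (\<integral>\<omega>. \<bar>?W \<omega> * kern k x (X 0 \<omega>) - ?W \<omega> * kern k x' (X 0 \<omega>)\<bar> \<partial>M)"
    by (rule integral_abs_bound)
  also have "\<dots> \<le> (\<integral>\<omega>. \<eta> * \<bar>?W \<omega>\<bar> \<partial>M)"
  proof (rule integral_mono)
    show "\<bar>?W \<omega> * kern k x (X 0 \<omega>) - ?W \<omega> * kern k x' (X 0 \<omega>)\<bar> \<le> \<eta> * \<bar>?W \<omega>\<bar>" for \<omega>
      using \<eta>[of "X 0 \<omega>"]
      by (simp add: right_diff_distrib[symmetric] abs_mult mult.commute[of \<eta>] mult_left_mono)
  qed (use w in \<open>auto intro!: integrable_kern\<close>)
  finally show ?thesis by simp
qed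

text \<open>The modulus is random: it is scaled by the sample average of the absolute weight, which
  the ergodic theorem eventually bounds.\<close>

lemma kavg_equicontinuous:
  assumes \<eta>: "\<And>u. \<bar>kern k x u - kern k x' u\<bar> \<le> \<eta>"
  shows "\<bar>kavg w k n \<omega> x - kavg w k n \<omega> x'\<bar> \<le> \<eta> * ((\<Sum>j<n. \<bar>w (X j \<omega>, Y j \<omega>)\<bar>) / real n)"
proof -
  have "\<bar>(\<Sum>j<n. w (X j \<omega>, Y j \<omega>) * kern k x (X j \<omega>)) - (\<Sum>j<n. w (X j \<omega>, Y j \<omega>) * kern k x' (X j \<omega>))\<bar>
      \<le> (\<Sum>j<n. \<eta> * \<bar>w (X j \<omega>, Y j \<omega>)\<bar>)"
    unfolding sum_subtractf[symmetric]
    by (intro order_trans[OF sum_abs] sum_mono)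
       (use \<eta> in \<open>simp add: right_diff_distrib[symmetric] abs_mult mult.commute[of \<eta>] mult_left_mono\<close>)
  then show ?thesis
    unfolding kavg_def diff_divide_distrib[symmetric]
    by (simp add: sum_distrib_left[symmetric] divide_right_mono)
qed

lemma continuous_kmean:
  assumes w: "integrable M (\<lambda>\<omega>. w (X 0 \<omega>, Y 0 \<omega>))"
  shows "continuous_on UNIV (kmean w k)"
proof (rule continuous_onI)
  fix x and e :: real assume "e > 0"
  let ?A = "\<integral>\<omega>. \<bar>w (X 0 \<omega>, Y 0 \<omega>)\<bar> \<partial>M"
  have A: "?A \<ge> 0" by simp
  \<comment> \<open>Adding 1 keeps the denominator positive when \<open>?A\<close> is 0.\<close>
  define \<eta> where "\<eta> = e / (?A + 1)"
  have \<eta>: "\<eta> > 0" unfolding \<eta>_def by (intro divide_pos_pos add_nonneg_pos A \<open>e > 0\<close> zero_less_one)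
  obtain \<delta> where \<delta>: "\<delta> > 0" "\<And>x x' u. dist x x' < \<delta> \<Longrightarrow> \<bar>kern k x u - kern k x' u\<bar> < \<eta>"
    using kern_equicontinuous[OF \<eta>] by blast
  have "dist (kmean w k x') (kmean w k x) \<le> e" if "dist x' x < \<delta>" for x'
  proof -
    have "dist (kmean w k x') (kmean w k x) \<le> \<eta> * ?A"
      unfolding dist_real_def using \<delta>(2)[OF that] by (intro kmean_equicontinuous w less_imp_le)
    also have "\<dots> \<le> \<eta> * (?A + 1)" using \<eta> by simp
    also have "\<dots> = e" using add_nonneg_pos[OF A zero_less_one] unfolding \<eta>_def by auto
    finally show ?thesis .
  qed
  then show "\<exists>d>0. \<forall>x'\<in>UNIV. dist x' x < d \<longrightarrow> dist (kmean w k x') (kmean w k x) \<le> e"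
    using \<delta>(1) by blast
qed

text \<open>The ergodic theorem is used only at the countably many centres in \<open>D\<close> and
  once for the absolute weight, so a single null set serves all compact \<open>C\<close>.\<close>

lemma AE_uniform_limit_kavg:
  assumes wm: "w \<in> borel_measurable borel" and w: "integrable M (\<lambda>\<omega>. w (X 0 \<omega>, Y 0 \<omega>))"
  shows "AE \<omega> in M. \<forall>C. compact C \<longrightarrow> uniform_limit C (\<lambda>n. kavg w k n \<omega>) (kmean w k) sequentially"
proof -
  let ?A = "\<integral>\<omega>. \<bar>w (X 0 \<omega>, Y 0 \<omega>)\<bar> \<partial>M"
  obtain D :: "'a set" where D: "countable D" "\<And>U. open U \<Longrightarrow> U \<noteq> {} \<Longrightarrow> \<exists>d\<in>D. d \<in> U"
    using countable_dense_setE by blast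
  have "AE \<omega> in M. \<forall>d\<in>D. (\<lambda>n. kavg w k n \<omega> d) \<longlonglongrightarrow> kmean w k d"
    unfolding kavg_def kmean_def AE_ball_countable[OF D(1)]
  proof
    fix d assume "d \<in> D"
    have m: "(\<lambda>z. w z * kern k d (fst z)) \<in> borel_measurable borel"
    proof -
      have "(\<lambda>z::'a \<times> real. kern k d (fst z)) \<in> borel_measurable borel"
        by (intro borel_measurable_continuous_onI continuous_on_compose2[OF continuous_K] continuous_intros) auto
      then show ?thesis using wm by simp
    qed
    from ergodic_process_average[OF prob_space_axioms stationary ergodic m] integrable_kern[OF w]
    show "AE \<omega> in M. (\<lambda>n. (\<Sum>j<n. w (X j \<omega>, Y j \<omega>) * kern k d (X j \<omega>)) / real n)
        \<longlonglongrightarrow> (\<integral>\<omega>. w (X 0 \<omega>, Y 0 \<omega>) * kern k d (X 0 \<omega>) \<partial>M)"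
      by simp
  qed
  moreover have "AE \<omega> in M. (\<lambda>n. (\<Sum>j<n. \<bar>w (X j \<omega>, Y j \<omega>)\<bar>) / real n) \<longlonglongrightarrow> ?A"
    using ergodic_process_average[OF prob_space_axioms stationary ergodic, of "\<lambda>z. \<bar>w z\<bar>"] w wm by simp
  ultimately show ?thesis
  proof eventually_elim
    case (elim \<omega>)
    show ?case
    proof (intro allI impI)
      fix C :: "'a set" assume C: "compact C"
      show "uniform_limit C (\<lambda>n. kavg w k n \<omega>) (kmean w k) sequentially"
      proof (rule uniform_limit_of_dense[OF D(2) _ _ C])
        show "(\<lambda>n. kavg w k n \<omega> d) \<longlonglongrightarrow> kmean w k d" if "d \<in> D" for d
          using elim(1) that by blast
        fix \<epsilon> :: real assume "\<epsilon> > 0"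
        have A: "?A \<ge> 0" by simp
        define \<eta> where "\<eta> = \<epsilon> / (?A + 1)"
        have \<eta>: "\<eta> > 0" "\<eta> * (?A + 1) = \<epsilon>"
          using add_nonneg_pos[OF A zero_less_one] \<open>\<epsilon> > 0\<close> unfolding \<eta>_def
          by (auto intro: divide_pos_pos)
        then obtain \<delta> where \<delta>: "\<delta> > 0" "\<And>x x' u. dist x x' < \<delta> \<Longrightarrow> \<bar>kern k x u - kern k x' u\<bar> < \<eta>"
          using kern_equicontinuous[of \<eta> k] by blast
        \<comment> \<open>The average absolute weight tends to \<open>?A\<close>, so it is
          eventually below the constant \<open>?A + 1\<close> built into
          \<open>\<eta>\<close>.\<close>
        have "\<forall>\<^sub>F n in sequentially. (\<Sum>j<n. \<bar>w (X j \<omega>, Y j \<omega>)\<bar>) / real n < ?A + 1"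
          by (rule order_tendstoD(2)[OF elim(2)]) simp
        then have "\<forall>\<^sub>F n in sequentially. \<forall>x x'. dist x x' < \<delta> \<longrightarrow> \<bar>kavg w k n \<omega> x - kavg w k n \<omega> x'\<bar> \<le> \<epsilon>"
        proof eventually_elim
          case (elim n)
          show ?case
          proof (intro allI impI)
            fix x x' :: 'a assume "dist x x' < \<delta>"
            then have "\<bar>kavg w k n \<omega> x - kavg w k n \<omega> x'\<bar> \<le> \<eta> * ((\<Sum>j<n. \<bar>w (X j \<omega>, Y j \<omega>)\<bar>) / real n)"
              by (intro kavg_equicontinuous less_imp_le \<delta>(2))
            also have "\<dots> \<le> \<eta> * (?A + 1)" using elim \<eta> by (intro mult_left_mono) auto
            finally show "\<bar>kavg w k n \<omega> x - kavg w k n \<omega> x'\<bar> \<le> \<epsilon>" using \<eta> by simp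
          qed
        qed
        moreover have "\<bar>kmean w k x - kmean w k x'\<bar> \<le> \<epsilon>" if "dist x x' < \<delta>" for x x' :: 'a
        proof -
          have "\<bar>kmean w k x - kmean w k x'\<bar> \<le> \<eta> * ?A"
            using that by (intro kmean_equicontinuous w less_imp_le \<delta>(2))
          also have "\<dots> \<le> \<eta> * (?A + 1)" using \<eta>(1) by simp
          finally show ?thesis using \<eta> by simp
        qed
        ultimately show "\<exists>\<delta>>0.
            (\<forall>\<^sub>F n in sequentially. \<forall>x x'. dist x x' < \<delta> \<longrightarrow> \<bar>kavg w k n \<omega> x - kavg w k n \<omega> x'\<bar> \<le> \<epsilon>) \<and>
            (\<forall>x x'. dist x x' < \<delta> \<longrightarrow> \<bar>kmean w k x - kmean w k x'\<bar> \<le> \<epsilon>)"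
          using \<delta>(1) by blast
      qed
    qed
  qed
qed

text \<open>The kernel is at least \<open>b\<close> within distance \<open>r * hbw k\<close> of
  \<open>x\<close>, and that neighbourhood has positive probability on the support.\<close>

lemma kmean_pos:
  assumes "x \<in> supp \<mu>"
  shows "kmean (\<lambda>_. 1) k x > 0"
proof -
  \<comment> \<open>\<open>supp\<close> tests only reciprocals of positive integers as radii, so one
    below \<open>r * hbw k\<close> is selected.\<close>
  obtain m :: nat where m: "inverse (real (Suc m)) < r * hbw k"
    using reals_Archimedean[of "r * hbw k"] r_pos by auto
  define E where "E = X 0 -` cball x (1 / real (Suc m)) \<inter> space M"
  have E: "E \<in> events" unfolding E_def by measurable
  have "prob E > 0"
    using assms unfolding supp_def E_def by (auto simp: measure_distr dest!: spec[of _ "Suc m"])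
  then have "0 < b * prob E" using b_pos by simp
  also have "\<dots> = (\<integral>\<omega>. b * indicator E \<omega> \<partial>M)" using E by simp
  also have "\<dots> \<le> kmean (\<lambda>_. 1) k x"
    unfolding kmean_def
  proof (rule integral_mono)
    show "integrable M (\<lambda>\<omega>. b * indicator E \<omega>)" using E by (simp add: emeasure_eq_measure)
    show "integrable M (\<lambda>\<omega>. 1 * kern k x (X 0 \<omega>))" by (rule integrable_kern) simp
    fix \<omega>
    show "b * indicator E \<omega> \<le> 1 * kern k x (X 0 \<omega>)"
    proof (cases "\<omega> \<in> E")
      case True
      then have "norm (X 0 \<omega> - x) < r * hbw k"
        using m by (auto simp: E_def dist_norm norm_minus_commute inverse_eq_divide)
      then have "norm ((1 / hbw k) *\<^sub>R (X 0 \<omega> - x)) \<le> r"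
        by (simp add: less_imp_le divide_le_eq)
      then show ?thesis using True K_ge_b by simp
    qed (simp add: K_nonneg)
  qed
  finally show ?thesis .
qed

section \<open>The regression ratios at a fixed bandwidth\<close>

lemma Mhat_eq: "Mhat K X Y k n x \<omega> = kavg snd k n \<omega> x / kavg (\<lambda>_. 1) k n \<omega> x"
  \<comment> \<open>The two divisions by \<open>n\<close> cancel; for \<open>n = 0\<close> both
    sides are 0 by the convention on division by 0.\<close>
  unfolding Mhat_def kavg_def by (cases "n = 0") auto

lemma Mstar_eq: "Mstar M K X Y k x = kmean snd k x / kmean (\<lambda>_. 1) k x"
  unfolding Mstar_def kmean_def by simp

text \<open>On a compact part of the support the limiting denominator is continuous and positive,
  hence bounded away from 0, as division of uniform limits requires.\<close>

lemma AE_uniform_limit_Mhat: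
  "AE \<omega> in M. \<forall>C. compact C \<longrightarrow> C \<subseteq> supp \<mu> \<longrightarrow>
     uniform_limit C (\<lambda>n x. Mhat K X Y k n x \<omega>) (Mstar M K X Y k) sequentially"
proof -
  have "snd \<in> borel_measurable (borel :: ('a \<times> real) measure)"
    by (intro borel_measurable_continuous_onI continuous_intros)
  then have "AE \<omega> in M. \<forall>C. compact C \<longrightarrow> uniform_limit C (\<lambda>n. kavg snd k n \<omega>) (kmean snd k) sequentially"
    using integrable_Y by (intro AE_uniform_limit_kavg) auto
  moreover have "AE \<omega> in M. \<forall>C. compact C \<longrightarrow>
      uniform_limit C (\<lambda>n. kavg (\<lambda>_. 1) k n \<omega>) (kmean (\<lambda>_. 1) k) sequentially"
    by (intro AE_uniform_limit_kavg) auto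
  ultimately show ?thesis
  proof eventually_elim
    case (elim \<omega>)
    show ?case
    proof (intro allI impI)
      fix C assume C: "compact C" "C \<subseteq> supp \<mu>"
      have cs: "continuous_on C (kmean snd k)" "continuous_on C (kmean (\<lambda>_. 1) k)"
        using integrable_Y by (intro continuous_on_subset[OF continuous_kmean]; simp)+
      obtain c where c: "c > 0" "\<And>x. x \<in> C \<Longrightarrow> c \<le> kmean (\<lambda>_. 1) k x"
      \<comment> \<open>The minimum of the limiting denominator serves as \<open>c\<close>; the
        empty set has none, and there 1 will do.\<close>
      proof (cases "C = {}")
        case True
        then show ?thesis using that[of 1] by simp
      next
        case False
        then obtain x0 where "x0 \<in> C" "\<forall>x\<in>C. kmean (\<lambda>_. 1) k x0 \<le> kmean (\<lambda>_. 1) k x"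
          using continuous_attains_inf[OF C(1) _ cs(2)] by blast
        then show ?thesis using that[of "kmean (\<lambda>_. 1) k x0"] kmean_pos C(2) by blast
      qed
      have "uniform_limit C (\<lambda>n x. kavg snd k n \<omega> x / kavg (\<lambda>_. 1) k n \<omega> x)
          (\<lambda>x. kmean snd k x / kmean (\<lambda>_. 1) k x) sequentially"
      proof (rule uniform_lim_divide)
        show "bounded (kmean snd k ` C)"
          by (rule compact_imp_bounded[OF compact_continuous_image[OF cs(1) C(1)]])
        show "c \<le> norm (kmean (\<lambda>_. 1) k x)" if "x \<in> C" for x
          using c(2)[OF that] by simp
      qed (use elim C c in auto)
      then show "uniform_limit C (\<lambda>n x. Mhat K X Y k n x \<omega>) (Mstar M K X Y k) sequentially"
        unfolding Mhat_eq Mstar_eq[abs_def] .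
    qed
  qed
qed

section \<open>The truncated series\<close>

lemma summable_clip_bound: "summable (\<lambda>j. L * 2 powr (- real (j + 2)))"
proof -
  have "L * 2 powr (- real (j + 2)) = L / 4 * (1 / 2) ^ j" for j
    unfolding powr_minus powr_realpow[OF zero_less_numeral] by (simp add: power_add field_simps)
  then show ?thesis by (simp only:) (intro summable_mult summable_geometric, simp)
qed

text \<open>Moving the cutoff \<open>N n\<close> into the terms gives an infinite series of the same
  shape as \<open>mstar\<close>, with \<open>k = j + 2\<close>, to which the domination lemma
  applies.\<close>

lemma mhat_eq:
  "mhat K X Y N L n x \<omega> = Mhat K X Y 1 n x \<omega> +
     (\<Sum>j. if j + 2 \<le> N n then clip L (j + 2) (Mhat K X Y (j + 2) n x \<omega> - Mhat K X Y (j + 1) n x \<omega>) else 0)"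
proof -
  let ?c = "\<lambda>j. clip L (j + 2) (Mhat K X Y (j + 2) n x \<omega> - Mhat K X Y (j + 1) n x \<omega>)"
  have "(\<Sum>j. if j + 2 \<le> N n then ?c j else 0) = (\<Sum>j | j + 2 \<le> N n. if j + 2 \<le> N n then ?c j else 0)"
    by (rule suminf_finite) (auto intro: finite_subset[of _ "{..N n}"])
  also have "\<dots> = (\<Sum>k=2..N n. clip L k (Mhat K X Y k n x \<omega> - Mhat K X Y (k - 1) n x \<omega>))"
    by (rule sum.reindex_bij_witness[of _ "\<lambda>k. k - 2" "\<lambda>j. j + 2"]) auto
  finally show ?thesis unfolding mhat_def by simp
qed

text \<open>The clipping bounds dominate all terms, cut off or not, so termwise convergence suffices
  however fast \<open>N n\<close> grows.\<close>

lemma AE_uniform_limit_mhat: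
  "AE \<omega> in M. \<forall>C. compact C \<longrightarrow> C \<subseteq> supp \<mu> \<longrightarrow>
     uniform_limit C (\<lambda>n x. mhat K X Y N L n x \<omega>) (mstar M K X Y L) sequentially"
proof -
  have "AE \<omega> in M. \<forall>k. \<forall>C. compact C \<longrightarrow> C \<subseteq> supp \<mu> \<longrightarrow>
     uniform_limit C (\<lambda>n x. Mhat K X Y k n x \<omega>) (Mstar M K X Y k) sequentially"
    unfolding AE_all_countable using AE_uniform_limit_Mhat by blast
  then show ?thesis
  proof eventually_elim
    case (elim \<omega>)
    show ?case
    proof (intro allI impI)
      fix C assume "compact C" "C \<subseteq> supp \<mu>"
      then have lim: "uniform_limit C (\<lambda>n x. Mhat K X Y k n x \<omega>) (Mstar M K X Y k) sequentially" for k
        using elim by blast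
      have "uniform_limit C (\<lambda>n x. Mhat K X Y 1 n x \<omega> +
          (\<Sum>j. if j + 2 \<le> N n then clip L (j + 2) (Mhat K X Y (j + 2) n x \<omega> - Mhat K X Y (j + 1) n x \<omega>) else 0))
        (\<lambda>x. Mstar M K X Y 1 x + (\<Sum>j. clip L (j + 2) (Mstar M K X Y (j + 2) x - Mstar M K X Y (j + 1) x)))
        sequentially"
      proof (intro uniform_limit_add lim uniform_limit_suminf_dominated summable_clip_bound)
        fix j
        \<comment> \<open>For a fixed \<open>j\<close> the cutoff is eventually inactive.\<close>
        have "\<forall>\<^sub>F n in sequentially. j + 2 \<le> N n"
          using N_at_top by (simp add: filterlim_at_top)
        then have ev: "\<forall>\<^sub>F n in sequentially. \<forall>x\<in>C.
            clip L (j + 2) (Mhat K X Y (j + 2) n x \<omega> - Mhat K X Y (j + 1) n x \<omega>) =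
            (if j + 2 \<le> N n then clip L (j + 2) (Mhat K X Y (j + 2) n x \<omega> - Mhat K X Y (j + 1) n x \<omega>) else 0)"
          by eventually_elim simp
        show "uniform_limit C (\<lambda>n x. if j + 2 \<le> N n
              then clip L (j + 2) (Mhat K X Y (j + 2) n x \<omega> - Mhat K X Y (j + 1) n x \<omega>) else 0)
            (\<lambda>x. clip L (j + 2) (Mstar M K X Y (j + 2) x - Mstar M K X Y (j + 1) x)) sequentially"
          by (rule iffD1[OF uniform_limit_cong[OF ev refl]])
             (intro uniform_limit_clip uniform_limit_minus lim less_imp_le[OF L_pos])
        fix n x
        show "\<bar>if j + 2 \<le> N n then clip L (j + 2) (Mhat K X Y (j + 2) n x \<omega> - Mhat K X Y (j + 1) n x \<omega>) else 0\<bar>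
            \<le> L * 2 powr (- real (j + 2))"
          and "\<bar>clip L (j + 2) (Mstar M K X Y (j + 2) x - Mstar M K X Y (j + 1) x)\<bar> \<le> L * 2 powr (- real (j + 2))"
          using abs_clip_le[OF less_imp_le[OF L_pos], of "j + 2"] L_pos by auto
      qed (rule summable_clip_bound)
      then show "uniform_limit C (\<lambda>n x. mhat K X Y N L n x \<omega>) (mstar M K X Y L) sequentially"
        unfolding mhat_eq mstar_def[abs_def] .
    qed
  qed
qed

section \<open>Support, measurability and bounds for the estimator and its limit\<close>

lemma finite_measure_\<mu>: "finite_measure \<mu>"
  by (intro prob_space.finite_measure prob_space_distr) simp

lemma compact_supp: "bounded (supp \<mu>) \<Longrightarrow> compact (supp \<mu>)"
  by (simp add: compact_eq_bounded_closed closed_supp finite_measure_\<mu>)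

lemma supp_nonempty: "supp \<mu> \<noteq> {}"
proof
  assume "supp \<mu> = {}"
  interpret D: prob_space \<mu> by (rule prob_space_distr) simp
  have "AE x in \<mu>. False"
    using AE_in_supp[OF finite_measure_\<mu>] \<open>supp \<mu> = {}\<close> by simp
  then show False by simp
qed

lemma measurable_mhat: "(\<lambda>x. mhat K X Y N L n x \<omega>) \<in> borel_measurable borel"
  unfolding mhat_def Mhat_def clip_eq[OF less_imp_le[OF L_pos]] by measurable

lemma measurable_mstar: "mstar M K X Y L \<in> borel_measurable borel"
proof -
  have [measurable]: "kmean snd k \<in> borel_measurable borel" "kmean (\<lambda>_. 1) k \<in> borel_measurable borel" for k
    using integrable_Y by (intro borel_measurable_continuous_onI continuous_kmean; simp)+
  show ?thesis
    unfolding mstar_def[abs_def] Mstar_eq clip_eq[OF less_imp_le[OF L_pos]] by measurable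
qed

text \<open>The first term is an average of responses with nonnegative weights, or 0 when all
  weights vanish; the clipped terms are bounded by their geometric series.\<close>

lemma abs_mhat_le:
  assumes D: "\<And>j. \<bar>Y j \<omega>\<bar> \<le> D"
  shows "\<bar>mhat K X Y N L n x \<omega>\<bar> \<le> D + (\<Sum>j. L * 2 powr (- real (j + 2)))"
proof -
  have D0: "D \<ge> 0" using D[of 0] by linarith
  have 1: "\<bar>Mhat K X Y 1 n x \<omega>\<bar> \<le> D"
  proof -
    let ?w = "\<lambda>j. kern 1 x (X j \<omega>)"
    have s: "(\<Sum>j<n. ?w j) \<ge> 0" by (intro sum_nonneg K_nonneg)
    have "\<bar>\<Sum>j<n. Y j \<omega> * ?w j\<bar> \<le> (\<Sum>j<n. D * ?w j)"
      by (intro order_trans[OF sum_abs] sum_mono) (simp add: abs_mult K_nonneg D mult_right_mono)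
    also have "\<dots> = D * (\<Sum>j<n. ?w j)" by (simp add: sum_distrib_left)
    finally have "\<bar>\<Sum>j<n. Y j \<omega> * ?w j\<bar> \<le> D * (\<Sum>j<n. ?w j)" .
    then show ?thesis
      unfolding Mhat_def abs_divide abs_of_nonneg[OF s]
      using s D0 by (cases "(\<Sum>j<n. ?w j) = 0") (auto simp: divide_le_eq)
  qed
  let ?f = "\<lambda>j. if j + 2 \<le> N n then clip L (j + 2) (Mhat K X Y (j + 2) n x \<omega> - Mhat K X Y (j + 1) n x \<omega>) else 0"
  have "norm (\<Sum>j. ?f j) \<le> (\<Sum>j. L * 2 powr (- real (j + 2)))"
  proof (rule norm_suminf_le[OF _ summable_clip_bound])
    fix j show "norm (?f j) \<le> L * 2 powr (- real (j + 2))"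
      using abs_clip_le[OF less_imp_le[OF L_pos], of "j + 2"] L_pos by auto
  qed
  with 1 show ?thesis unfolding mhat_eq by simp
qed

text \<open>Expectations replace the sums of the previous bound. Off the support the denominator may
  be 0, and then the ratio is 0, which \<open>D0\<close> covers.\<close>

lemma abs_mstar_le:
  assumes D: "AE \<omega> in M. \<bar>Y 0 \<omega>\<bar> \<le> D" and D0: "D \<ge> 0"
  shows "\<bar>mstar M K X Y L x\<bar> \<le> D + (\<Sum>j. L * 2 powr (- real (j + 2)))"
proof -
  have 1: "\<bar>Mstar M K X Y 1 x\<bar> \<le> D"
  proof -
    let ?w = "\<lambda>\<omega>. kern 1 x (X 0 \<omega>)"
    have s: "(\<integral>\<omega>. ?w \<omega> \<partial>M) \<ge> 0" by (simp add: K_nonneg)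
    have w: "integrable M ?w" using integrable_kern[of "\<lambda>_. 1" 1 x] by simp
    have "\<bar>\<integral>\<omega>. Y 0 \<omega> * ?w \<omega> \<partial>M\<bar> \<le> (\<integral>\<omega>. \<bar>Y 0 \<omega> * ?w \<omega>\<bar> \<partial>M)" by (rule integral_abs_bound)
    also have "\<dots> \<le> (\<integral>\<omega>. D * ?w \<omega> \<partial>M)"
    proof (rule integral_mono_AE)
      show "integrable M (\<lambda>\<omega>. \<bar>Y 0 \<omega> * ?w \<omega>\<bar>)" using integrable_kern[OF integrable_Y] by simp
      show "AE \<omega> in M. \<bar>Y 0 \<omega> * ?w \<omega>\<bar> \<le> D * ?w \<omega>"
        using D by eventually_elim (simp add: abs_mult K_nonneg mult_right_mono)
    qed (use w in simp)
    also have "\<dots> = D * (\<integral>\<omega>. ?w \<omega> \<partial>M)" by simp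
    finally have "\<bar>\<integral>\<omega>. Y 0 \<omega> * ?w \<omega> \<partial>M\<bar> \<le> D * (\<integral>\<omega>. ?w \<omega> \<partial>M)" .
    then show ?thesis
      unfolding Mstar_def abs_divide abs_of_nonneg[OF s]
      using s D0 by (cases "(\<integral>\<omega>. ?w \<omega> \<partial>M) = 0") (auto simp: divide_le_eq)
  qed
  let ?f = "\<lambda>j. clip L (j + 2) (Mstar M K X Y (j + 2) x - Mstar M K X Y (j + 1) x)"
  have "norm (\<Sum>j. ?f j)
      \<le> (\<Sum>j. L * 2 powr (- real (j + 2)))"
  proof (rule norm_suminf_le[OF _ summable_clip_bound])
    fix j show "norm (?f j) \<le> L * 2 powr (- real (j + 2))"
      using abs_clip_le[OF less_imp_le[OF L_pos], of "j + 2"] L_pos by auto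
  qed
  with 1 show ?thesis unfolding mstar_def by simp
qed

section \<open>Pointwise and mean-square convergence\<close>

text \<open>The null set of \<open>AE_uniform_limit_mhat\<close> does not depend on the compact set,
  so singletons give all points of the support at once.\<close>

lemma AE_pointwise: "AE \<omega> in M. \<forall>x \<in> supp \<mu>. (\<lambda>n. mhat K X Y N L n x \<omega>) \<longlonglongrightarrow> mstar M K X Y L x"
  using AE_uniform_limit_mhat
proof eventually_elim
  case (elim \<omega>)
  show ?case
  proof
    fix x assume "x \<in> supp \<mu>"
    then have "uniform_limit {x} (\<lambda>n x. mhat K X Y N L n x \<omega>) (mstar M K X Y L) sequentially"
      using elim[rule_format, of "{x}"] by simp
    then show "(\<lambda>n. mhat K X Y N L n x \<omega>) \<longlonglongrightarrow> mstar M K X Y L x"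
      by (rule tendsto_uniform_limitI) simp
  qed
qed

text \<open>Almost every \<open>x\<close> lies in the support, where pointwise convergence is known,
  and the errors share a constant bound, so dominated convergence applies.\<close>

lemma AE_L2_bounded_response:
  assumes D: "AE \<omega> in M. \<bar>Y 0 \<omega>\<bar> \<le> D"
  shows "AE \<omega> in M. (\<lambda>n. \<integral>\<^sup>+x. ennreal ((mhat K X Y N L n x \<omega> - mstar M K X Y L x)\<^sup>2) \<partial>\<mu>) \<longlonglongrightarrow> 0"
proof -
  interpret D: prob_space \<mu> by (rule prob_space_distr) simp
  have D0: "D \<ge> 0"
  proof (rule ccontr)
    assume "\<not> D \<ge> 0"
    then have "AE \<omega> in M. False" by (intro eventually_mono[OF D]) linarith
    then show False by simp
  qed
  have "{z :: 'a \<times> real. \<bar>snd z\<bar> \<le> D} \<in> sets borel"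
    by (intro borel_closed closed_Collect_le continuous_intros)
  \<comment> \<open>The estimator involves all responses, so the bound is needed for every
    \<open>Y j\<close> on one almost sure event.\<close>
  from stationary_process_AE[OF stationary this] D
  have "AE \<omega> in M. \<forall>j. \<bar>Y j \<omega>\<bar> \<le> D" by simp
  with AE_pointwise show ?thesis
  proof eventually_elim
    case (elim \<omega>)
    let ?B = "D + (\<Sum>j. L * 2 powr (- real (j + 2)))"
    let ?u = "\<lambda>n x. ennreal ((mhat K X Y N L n x \<omega> - mstar M K X Y L x)\<^sup>2)"
    note [measurable] = measurable_mhat measurable_mstar
    have "(\<lambda>n. \<integral>\<^sup>+x. ?u n x \<partial>\<mu>) \<longlonglongrightarrow> (\<integral>\<^sup>+x. 0 \<partial>\<mu>)"
    \<comment> \<open>\<open>?B\<close> bounds the estimator and the limit separately, hence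
      \<open>2 * ?B\<close> bounds their difference.\<close>
    proof (rule nn_integral_dominated_convergence[where w = "\<lambda>_. ennreal ((2 * ?B)\<^sup>2)"])
      show "AE x in \<mu>. ?u n x \<le> ennreal ((2 * ?B)\<^sup>2)" for n
      proof (intro AE_I2 ennreal_leI)
        fix x
        have "\<bar>mhat K X Y N L n x \<omega> - mstar M K X Y L x\<bar> \<le> 2 * ?B"
          using abs_mhat_le[of \<omega> D n x] abs_mstar_le[OF D D0, of x] elim(2) by fastforce
        then show "(mhat K X Y N L n x \<omega> - mstar M K X Y L x)\<^sup>2 \<le> (2 * ?B)\<^sup>2"
          by (metis abs_ge_zero power2_abs power_mono)
      qed
      show "(\<integral>\<^sup>+x. ennreal ((2 * ?B)\<^sup>2) \<partial>\<mu>) < \<infinity>"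
        using D.emeasure_space_1 by (simp add: ennreal_mult_less_top)
      show "AE x in \<mu>. (\<lambda>n. ?u n x) \<longlonglongrightarrow> 0"
        using AE_in_supp[OF finite_measure_\<mu>, simplified]
      proof eventually_elim
        case (elim x)
        then have "(\<lambda>n. mhat K X Y N L n x \<omega> - mstar M K X Y L x) \<longlonglongrightarrow> 0"
          using \<open>\<forall>x\<in>supp \<mu>. _ x\<close> by (simp add: LIM_zero_iff)
        from tendsto_power[OF this, of 2] have "(\<lambda>n. (mhat K X Y N L n x \<omega> - mstar M K X Y L x)\<^sup>2) \<longlonglongrightarrow> 0"
          by simp
        from tendsto_ennrealI[OF this] show ?case by simp
      qed
    qed measurable
    then show ?case by simp
  qed
qed

end

text \<open>The integral in the last part is extended-real valued, so its convergence to 0 includes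
  eventual finiteness.\<close>

theorem theorem2:
  fixes M :: "'m measure"
    and X :: "nat \<Rightarrow> 'm \<Rightarrow> 'a::euclidean_space"
    and Y :: "nat \<Rightarrow> 'm \<Rightarrow> real"
    and K :: "'a \<Rightarrow> real"
    and b r L :: real
    and N :: "nat \<Rightarrow> nat"
  assumes "prob_space M"
    and "stationary_process M (\<lambda>i \<omega>. (X i \<omega>, Y i \<omega>))"
    and "ergodic_process M (\<lambda>i \<omega>. (X i \<omega>, Y i \<omega>))"
    and "integrable M (Y 0)"
    and "continuous_on UNIV K"
    and "0 < b" and "b \<le> 1" and "0 < r" and "r < 1"
    and "\<And>x. b * indicator (cball 0 r) x \<le> K x"
    and "\<And>x. K x \<le> indicator (cball 0 1) x"
    and "L > 0"
    and "mono N" and "\<And>n. N n \<ge> 1" and "filterlim N at_top sequentially"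
  shows
    "(AE \<omega> in M. \<forall>x \<in> supp (distr M borel (X 0)).
        (\<lambda>n. mhat K X Y N L n x \<omega>) \<longlonglongrightarrow> mstar M K X Y L x)
     \<and> (bounded (supp (distr M borel (X 0))) \<longrightarrow>
        (AE \<omega> in M. (\<lambda>n. SUP x \<in> supp (distr M borel (X 0)).
             \<bar>mhat K X Y N L n x \<omega> - mstar M K X Y L x\<bar>) \<longlonglongrightarrow> 0))
     \<and> (((\<exists>D. AE \<omega> in M. \<bar>Y 0 \<omega>\<bar> \<le> D) \<or> bounded (supp (distr M borel (X 0)))) \<longrightarrow>
        (AE \<omega> in M. (\<lambda>n. \<integral>\<^sup>+ x. ennreal ((mhat K X Y N L n x \<omega> - mstar M K X Y L x)\<^sup>2)
             \<partial>(distr M borel (X 0))) \<longlonglongrightarrow> 0))"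
proof -
  interpret kernel_regression M X Y K b r L N
    using assms by (auto simp: kernel_regression_def kernel_regression_axioms_def)
  \<comment> \<open>A bounded support is compact because it is closed, so it may itself be taken as
    the compact set; this serves both the supremum and the integral.\<close>
  have unif: "AE \<omega> in M. uniform_limit (supp \<mu>) (\<lambda>n x. mhat K X Y N L n x \<omega>) (mstar M K X Y L) sequentially"
    if "bounded (supp \<mu>)"
    using AE_uniform_limit_mhat by eventually_elim (use compact_supp[OF that] in blast)
  show ?thesis
  proof (intro conjI impI AE_pointwise)
    assume "bounded (supp \<mu>)"
    from unif[OF this]
    show "AE \<omega> in M. (\<lambda>n. SUP x\<in>supp \<mu>. \<bar>mhat K X Y N L n x \<omega> - mstar M K X Y L x\<bar>) \<longlonglongrightarrow> 0"
      by eventually_elim (rule SUP_tendsto_0[OF supp_nonempty])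
  next
    assume "(\<exists>D. AE \<omega> in M. \<bar>Y 0 \<omega>\<bar> \<le> D) \<or> bounded (supp \<mu>)"
    then show "AE \<omega> in M. (\<lambda>n. \<integral>\<^sup>+x. ennreal ((mhat K X Y N L n x \<omega> - mstar M K X Y L x)\<^sup>2) \<partial>\<mu>) \<longlonglongrightarrow> 0"
    proof
      assume "\<exists>D. AE \<omega> in M. \<bar>Y 0 \<omega>\<bar> \<le> D"
      then show ?thesis using AE_L2_bounded_response by blast
    next
      assume "bounded (supp \<mu>)"
      from unif[OF this] show ?thesis
      proof eventually_elim
        case (elim \<omega>)
        show ?case
          by (rule nn_integral_tendsto_0_of_uniform_limit[OF prob_space_distr AE_in_supp elim])
             (simp_all add: finite_measure_\<mu>)
      qed
    qed
  qed
qed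

end
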